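(* Let $A\in\mathbb R^{d\times d}$ and $V\in\mathbb R^{k\times d}$ be nonzero matrices and $n\in\mathbb N$, and let $f$ be self-attention with parameters $(A,V)$. Let $\mathcal E_A\subset\overline B(0,1)^n$ be the set of sequences $(x_1,\dots,x_n)$ such that for every $i\in\{1,\dots,n\}$ the maximum $\max_{1\le j\le n}x_i^\top A^\top x_j$ is attained at a unique index $j$. Then the complement of $\mathcal E_A$ in $\overline B(0,1)^n$ has zero Lebesgue measure, and for every $X\in\mathcal E_A$ there exists a function $\theta:[0,+\infty)\to[0,+\infty)$ such that $\theta(R)\to1$ exponentially fast as $R\to+\infty$ and, for all $R\ge0$, $$\|D_{RX}f\|_2\le\theta(R)\,\|V\|_2\sqrt n.$$
   Context: For $X=(x_1,\dots,x_n)\in(\mathbb R^d)^n$, $f(X)=\big(V\sum_{j=1}^nP_{ij}x_j\big)_{1\le i\le n}$ with $P_{ij}=\exp(x_i^\top A^\top x_j)/\sum_{l=1}^n\exp(x_i^\top A^\top x_l)$. $\overline B(0,1)$ is the closed unit ball of $\mathbb R^d$. $D_Xf$ is the differential of $f$ at $X$ and $\|D_Xf\|_2$ its operator norm with respect to the Frobenius norms $\|X\|_F=(\sum_i|x_i|^2)^{1/2}$ on $(\mathbb R^d)^n$ and $(\mathbb R^k)^n$; $RX=(Rx_1,\dots,Rx_n)$. $\|V\|_2$ is the spectral norm. *)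

theory Defs
  imports "HOL-Analysis.Analysis"
begin

text \<open>A sequence X = (x_1,...,x_n) in (R^d)^n is an element of real^'d^'n, with x_i = X$i.
  The norm on real^'d^'n is exactly the Frobenius norm sqrt(sum_i |x_i|^2).\<close>

definition attn_score :: "real^'d^'d \<Rightarrow> real^'d^'n \<Rightarrow> 'n \<Rightarrow> 'n \<Rightarrow> real" where
  "attn_score A X i j = (A *v (X$i)) \<bullet> (X$j)"   (* = x_i^T A^T x_j *)

definition attn_P :: "real^'d^'d \<Rightarrow> real^'d^'n \<Rightarrow> 'n::finite \<Rightarrow> 'n \<Rightarrow> real" where
  "attn_P A X i j = exp (attn_score A X i j) / (\<Sum>l\<in>UNIV. exp (attn_score A X i l))"

definition self_attention :: "real^'d^'d \<Rightarrow> real^'d^'k \<Rightarrow> real^'d^'n::finite \<Rightarrow> real^'k^'n" where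
  "self_attention A V X = (\<chi> i. V *v (\<Sum>j\<in>UNIV. attn_P A X i j *\<^sub>R (X$j)))"

definition unit_ball_seq :: "(real^'d^'n) set" where
  "unit_ball_seq = {X. \<forall>i. X$i \<in> cball 0 1}"

definition E_set :: "real^'d^'d \<Rightarrow> (real^'d^'n) set" where
  "E_set A = {X \<in> unit_ball_seq. \<forall>i. \<exists>!j. \<forall>l. attn_score A X i l \<le> attn_score A X i j}"

end

theory Submission
  imports Defs "HOL-Real_Asymp.Real_Asymp"
begin

text \<open>
  The derivative of self-attention at Y in direction H is, row by row, V applied to
  \<open>\<Sum>j P_ij H_j + \<Sum>j (D P_ij) Y_j\<close>. The first part has norm at most \<open>\<parallel>V\<parallel>\<^sub>2 \<parallel>H\<parallel>\<close> per row, hence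
  at most \<open>\<parallel>V\<parallel>\<^sub>2 \<surd>n \<parallel>H\<parallel>\<close> in total; the softmax derivative satisfies
  \<open>|D P_ij| \<le> 4 \<parallel>A\<parallel> \<parallel>Y\<parallel> \<parallel>H\<parallel> P_ij (1 - P_ij)\<close>. On \<open>\<E>_A\<close> every row of scores has a strict
  maximiser with some gap d > 0, and scores scale like R^2 along \<open>R X\<close>, so
  \<open>P_ij (1 - P_ij) \<le> n exp(-d R^2)\<close> and \<open>\<theta>(R) = 1 + O(R^2 exp(-d R^2))\<close> works.

  A sequence outside \<open>\<E>_A\<close> has a tie \<open>x_i^T A^T (x_j - x_l) = 0\<close> with j \<noteq> l. Where
  \<open>A x_i = 0\<close> this lies in a hyperplane; elsewhere, after arranging i \<noteq> j, the tie set is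
  the preimage of a hyperplane under a map that perturbs one coordinate of \<open>x_j\<close> and has
  injective derivative, so it is negligible.
\<close>

subsection \<open>Vectors of vectors\<close>

lemma bounded_linear_axis: "bounded_linear (axis i :: 'a::real_normed_vector \<Rightarrow> 'a^'n::finite)"
proof (rule bounded_linear_intro[where K=1])
  show "axis i (x + y) = axis i x + axis i y" for x y :: 'a
    by (simp add: axis_def vec_eq_iff)
  show "axis i (r *\<^sub>R x) = r *\<^sub>R axis i x" for r and x :: 'a
    by (simp add: axis_def vec_eq_iff)
  show "norm (axis i x) \<le> norm x * 1" for x :: 'a
  proof -
    have "norm (axis i x) = L2_set (\<lambda>j. if j = i then norm x else 0) UNIV"
      unfolding norm_vec_def by (rule L2_set_cong) (auto simp: axis_def)
    also have "\<dots> = norm x"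
      by (simp add: L2_set_def if_distrib[of "\<lambda>t. t^2"] cong: if_cong)
    finally show ?thesis by simp
  qed
qed

lemma has_derivative_vec_lambda:
  fixes g :: "'n::finite \<Rightarrow> 'a::real_normed_vector \<Rightarrow> 'b::real_normed_vector"
  assumes "\<And>i. (g i has_derivative g' i) (at x)"
  shows "((\<lambda>x. \<chi> i. g i x) has_derivative (\<lambda>h. \<chi> i. g' i h)) (at x)"
proof -
  have vec_as_sum: "(\<chi> i. f i) = (\<Sum>i\<in>UNIV. axis i (f i))" for f :: "'n \<Rightarrow> 'b"
    by (simp add: vec_eq_iff axis_def sum_component)
  have "((\<lambda>x. \<Sum>i\<in>UNIV. axis i (g i x)) has_derivative (\<lambda>h. \<Sum>i\<in>UNIV. axis i (g' i h))) (at x)"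
    by (intro has_derivative_sum bounded_linear.has_derivative[OF bounded_linear_axis] assms)
  then show ?thesis by (simp add: vec_as_sum)
qed

lemma norm_vec_le_sqrt_card:
  fixes x :: "'a::real_normed_vector^'n::finite"
  assumes "\<And>i. norm (x$i) \<le> b"
  shows "norm x \<le> sqrt (real CARD('n)) * b"
proof -
  have b0: "b \<ge> 0" using assms[of undefined] norm_ge_zero order_trans by blast
  have "norm x = sqrt (\<Sum>i\<in>UNIV. (norm (x$i))^2)" by (simp add: norm_vec_def L2_set_def)
  also have "\<dots> \<le> sqrt (\<Sum>i\<in>(UNIV::'n set). b^2)"
    by (intro real_sqrt_le_mono sum_mono power_mono assms) auto
  also have "\<dots> = sqrt (real CARD('n)) * b" using b0 by (simp add: real_sqrt_mult)
  finally show ?thesis .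
qed

lemma norm_sum_scaleR_nth_le:
  fixes Y :: "'a::real_normed_vector^'n::finite"
  shows "norm (\<Sum>j\<in>UNIV. c j *\<^sub>R (Y$j)) \<le> (\<Sum>j\<in>UNIV. \<bar>c j\<bar>) * norm Y"
proof -
  have "norm (\<Sum>j\<in>UNIV. c j *\<^sub>R (Y$j)) \<le> (\<Sum>j\<in>UNIV. norm (c j *\<^sub>R (Y$j)))"
    by (rule norm_sum)
  also have "\<dots> \<le> (\<Sum>j\<in>UNIV. \<bar>c j\<bar> * norm Y)"
    by (intro sum_mono) (auto intro: mult_left_mono Finite_Cartesian_Product.norm_nth_le)
  finally show ?thesis by (simp add: sum_distrib_right)
qed

subsection \<open>The derivative of self-attention\<close>

definition attn_score_deriv :: "real^'d^'d \<Rightarrow> real^'d^'n \<Rightarrow> real^'d^'n \<Rightarrow> 'n \<Rightarrow> 'n \<Rightarrow> real" where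
  "attn_score_deriv A Y H i j = (A *v (H$i)) \<bullet> (Y$j) + (A *v (Y$i)) \<bullet> (H$j)"

definition attn_P_deriv :: "real^'d^'d \<Rightarrow> real^'d^'n::finite \<Rightarrow> real^'d^'n \<Rightarrow> 'n \<Rightarrow> 'n \<Rightarrow> real" where
  "attn_P_deriv A Y H i j =
     attn_P A Y i j * (attn_score_deriv A Y H i j - (\<Sum>l\<in>UNIV. attn_P A Y i l * attn_score_deriv A Y H i l))"

definition self_attention_deriv ::
    "real^'d^'d \<Rightarrow> real^'d^'k \<Rightarrow> real^'d^'n::finite \<Rightarrow> real^'d^'n \<Rightarrow> real^'k^'n" where
  "self_attention_deriv A V Y H =
     (\<chi> i. V *v (\<Sum>j\<in>UNIV. attn_P_deriv A Y H i j *\<^sub>R (Y$j) + attn_P A Y i j *\<^sub>R (H$j)))"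

lemma has_derivative_attn_score:
  fixes A :: "real^'d^'d" and Y :: "real^'d^'n::finite"
  shows "((\<lambda>Y. attn_score A Y i j) has_derivative (\<lambda>H. attn_score_deriv A Y H i j)) (at Y)"
proof -
  have "bounded_linear (\<lambda>Y::real^'d^'n. A *v (Y$i))"
    using bounded_linear_compose[OF matrix_vector_mul_bounded_linear bounded_linear_vec_nth] by blast
  from has_derivative_inner[OF bounded_linear.has_derivative[OF this has_derivative_ident]
      bounded_linear.has_derivative[OF bounded_linear_vec_nth has_derivative_ident]]
  show ?thesis unfolding attn_score_def attn_score_deriv_def
    by (rule has_derivative_eq_rhs) (auto simp: inner_commute add.commute)
qed

lemma sum_exp_attn_score_pos: "(\<Sum>l\<in>UNIV. exp (attn_score A Y i (l::'n::finite))) > 0"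
  by (rule sum_pos) auto

lemma has_derivative_attn_P:
  fixes A :: "real^'d^'d" and Y :: "real^'d^'n::finite"
  shows "((\<lambda>Y. attn_P A Y i j) has_derivative (\<lambda>H. attn_P_deriv A Y H i j)) (at Y)"
proof -
  have exp_score: "((\<lambda>Y. exp (attn_score A Y i l)) has_derivative
      (\<lambda>H. exp (attn_score A Y i l) * attn_score_deriv A Y H i l)) (at Y)" for l
    by (rule has_derivative_eq_rhs, rule has_derivative_exp[OF has_derivative_attn_score])
      (auto simp: mult.commute)
  have "((\<lambda>Y. \<Sum>l\<in>UNIV. exp (attn_score A Y i l)) has_derivative
      (\<lambda>H. \<Sum>l\<in>UNIV. exp (attn_score A Y i l) * attn_score_deriv A Y H i l)) (at Y)"
    by (rule has_derivative_sum, rule exp_score)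
  from has_derivative_divide'[OF exp_score this] show ?thesis
    unfolding attn_P_def[abs_def]
    by (rule has_derivative_eq_rhs)
      (use sum_exp_attn_score_pos[of A Y i] in \<open>auto simp: attn_P_deriv_def attn_P_def fun_eq_iff
        field_simps sum_divide_distrib[symmetric] sum_distrib_left\<close>)
qed

lemma frechet_derivative_self_attention:
  "frechet_derivative (self_attention A V) (at Y) = self_attention_deriv A V Y"
proof (rule frechet_derivative_at[symmetric])
  show "(self_attention A V has_derivative self_attention_deriv A V Y) (at Y)"
    unfolding self_attention_def[abs_def] self_attention_deriv_def[abs_def]
  proof (intro has_derivative_vec_lambda bounded_linear.has_derivative[OF matrix_vector_mul_bounded_linear]
      has_derivative_sum)
    fix i j
    from has_derivative_scaleR[OF has_derivative_attn_P
        bounded_linear.has_derivative[OF bounded_linear_vec_nth has_derivative_ident]]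
    show "((\<lambda>Y. attn_P A Y i j *\<^sub>R Y $ j) has_derivative
        (\<lambda>H. attn_P_deriv A Y H i j *\<^sub>R Y $ j + attn_P A Y i j *\<^sub>R H $ j)) (at Y)"
      by (rule has_derivative_eq_rhs) (simp add: fun_eq_iff add.commute)
  qed
qed

subsection \<open>Softmax estimates\<close>

lemma attn_P_nonneg: "attn_P A Y i j \<ge> 0"
  unfolding attn_P_def by (intro divide_nonneg_nonneg sum_nonneg) auto

lemma sum_attn_P: "(\<Sum>j\<in>UNIV. attn_P A Y i j) = 1"
  unfolding attn_P_def using sum_exp_attn_score_pos[of A Y i]
  by (simp add: sum_divide_distrib[symmetric])

lemma attn_P_le_1: "attn_P A Y i j \<le> 1"
  using member_le_sum[of j UNIV "attn_P A Y i"] by (simp add: attn_P_nonneg sum_attn_P)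

lemma norm_attn_average_le: "norm (\<Sum>j\<in>UNIV. attn_P A Y i j *\<^sub>R (H$j)) \<le> norm H"
  using norm_sum_scaleR_nth_le[of "attn_P A Y i" H] by (simp add: attn_P_nonneg sum_attn_P)

lemma abs_attn_score_deriv_le:
  fixes A :: "real^'d^'d" and Y :: "real^'d^'n::finite"
  shows "\<bar>attn_score_deriv A Y H i j\<bar> \<le> 2 * onorm ((*v) A) * norm Y * norm H"
proof -
  have bilinear_le: "\<bar>(A *v (U$p)) \<bullet> (W$q)\<bar> \<le> onorm ((*v) A) * norm U * norm W"
    for U W :: "real^'d^'n" and p q
  proof -
    have "\<bar>(A *v (U$p)) \<bullet> (W$q)\<bar> \<le> norm (A *v (U$p)) * norm (W$q)" by (rule Cauchy_Schwarz_ineq2)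
    also have "\<dots> \<le> (onorm ((*v) A) * norm (U$p)) * norm (W$q)"
      by (intro mult_right_mono onorm) auto
    also have "\<dots> \<le> (onorm ((*v) A) * norm U) * norm W"
      by (intro mult_mono mult_left_mono Finite_Cartesian_Product.norm_nth_le onorm_pos_le
          mult_nonneg_nonneg norm_ge_zero) auto
    finally show ?thesis .
  qed
  show ?thesis
    using bilinear_le[of H i Y j] bilinear_le[of Y i H j]
    unfolding attn_score_deriv_def by (simp add: algebra_simps)
qed

text \<open>The deviation of a score derivative from its P-weighted mean is a P-average of
  differences, the j-th of which vanishes; this produces the factor \<open>1 - P_ij\<close>.\<close>

lemma abs_attn_P_deriv_le:
  fixes A :: "real^'d^'d" and Y :: "real^'d^'n::finite"
  shows "\<bar>attn_P_deriv A Y H i j\<bar>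
     \<le> attn_P A Y i j * (1 - attn_P A Y i j) * (4 * onorm ((*v) A) * norm Y * norm H)"
proof -
  define D where "D = 2 * onorm ((*v) A) * norm Y * norm H"
  let ?P = "attn_P A Y i" and ?d = "\<lambda>l. attn_score_deriv A Y H i l"
  have diff_le: "\<bar>?d j - ?d l\<bar> \<le> 2 * D" for l
    using abs_attn_score_deriv_le[of A Y H i j] abs_attn_score_deriv_le[of A Y H i l]
    unfolding D_def by linarith
  have "?d j - (\<Sum>l\<in>UNIV. ?P l * ?d l) = (\<Sum>l\<in>UNIV. ?P l * (?d j - ?d l))"
    using sum_attn_P[of A Y i] by (simp add: algebra_simps sum_subtractf sum_distrib_right[symmetric])
  also have "\<bar>\<dots>\<bar> \<le> (\<Sum>l\<in>UNIV. \<bar>?P l * (?d j - ?d l)\<bar>)" by (rule sum_abs)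
  also have "\<dots> \<le> (\<Sum>l\<in>UNIV. 2 * D * ?P l - (if l = j then 2 * D * ?P l else 0))"
    using diff_le attn_P_nonneg[of A Y i]
    by (intro sum_mono) (auto simp: abs_mult mult.commute intro: mult_left_mono)
  also have "\<dots> = 2 * D * (1 - ?P j)"
    by (simp add: sum_subtractf sum_distrib_left[symmetric] sum_attn_P algebra_simps)
  finally have "\<bar>?d j - (\<Sum>l\<in>UNIV. ?P l * ?d l)\<bar> \<le> 2 * D * (1 - ?P j)" .
  then have "\<bar>attn_P_deriv A Y H i j\<bar> \<le> ?P j * (2 * D * (1 - ?P j))"
    unfolding attn_P_deriv_def using attn_P_nonneg[of A Y i j]
    by (auto simp: abs_mult intro: mult_left_mono)
  then show ?thesis by (simp add: D_def algebra_simps)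
qed

lemma onorm_self_attention_deriv_le:
  fixes A :: "real^'d^'d" and V :: "real^'d^'k" and Y :: "real^'d^'n::finite"
  assumes "\<And>i j. attn_P A Y i j * (1 - attn_P A Y i j) \<le> e"
  shows "onorm (self_attention_deriv A V Y)
    \<le> (1 + real CARD('n) * e * 4 * onorm ((*v) A) * (norm Y)^2) * onorm ((*v) V) * sqrt (real CARD('n))"
proof (rule onorm_le)
  fix H :: "real^'d^'n"
  let ?a = "onorm ((*v) A)" and ?v = "onorm ((*v) V)" and ?N = "real CARD('n)"
  let ?\<theta> = "1 + ?N * e * 4 * ?a * (norm Y)^2"
  have "norm (self_attention_deriv A V Y H $ i) \<le> ?v * (?\<theta> * norm H)" for i
  proof -
    have "\<bar>attn_P_deriv A Y H i j\<bar> \<le> e * (4 * ?a * norm Y * norm H)" for j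
      using abs_attn_P_deriv_le[of A Y H i j] assms[of i j]
        mult_right_mono[of _ e "4 * ?a * norm Y * norm H"] onorm_pos_le[of "(*v) A"]
      by fastforce
    then have sum_le: "(\<Sum>j\<in>UNIV. \<bar>attn_P_deriv A Y H i j\<bar>) \<le> ?N * (e * (4 * ?a * norm Y * norm H))"
      using sum_mono[of UNIV "\<lambda>j. \<bar>attn_P_deriv A Y H i j\<bar>" "\<lambda>_. e * (4 * ?a * norm Y * norm H)"]
      by simp
    have "norm (\<Sum>j\<in>UNIV. attn_P_deriv A Y H i j *\<^sub>R (Y$j) + attn_P A Y i j *\<^sub>R (H$j))
       \<le> norm (\<Sum>j\<in>UNIV. attn_P_deriv A Y H i j *\<^sub>R (Y$j)) + norm (\<Sum>j\<in>UNIV. attn_P A Y i j *\<^sub>R (H$j))"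
      by (simp add: sum.distrib norm_triangle_ineq)
    also have "\<dots> \<le> (\<Sum>j\<in>UNIV. \<bar>attn_P_deriv A Y H i j\<bar>) * norm Y + norm H"
      by (intro add_mono norm_sum_scaleR_nth_le norm_attn_average_le)
    also have "\<dots> \<le> ?\<theta> * norm H"
      using mult_right_mono[OF sum_le norm_ge_zero[of Y]]
      by (simp add: algebra_simps power2_eq_square)
    finally show ?thesis
      unfolding self_attention_deriv_def
      using onorm[OF matrix_vector_mul_bounded_linear, of V] onorm_pos_le[of "(*v) V"]
      by simp (meson mult_left_mono order_trans matrix_vector_mul_bounded_linear)
  qed
  then have "norm (self_attention_deriv A V Y H) \<le> sqrt ?N * (?v * (?\<theta> * norm H))"
    by (rule norm_vec_le_sqrt_card)
  then show "norm (self_attention_deriv A V Y H) \<le> ?\<theta> * ?v * sqrt ?N * norm H"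
    by (simp add: algebra_simps)
qed

subsection \<open>Concentration of the softmax\<close>

lemma attn_score_scaleR: "attn_score A (R *\<^sub>R X) i j = R^2 * attn_score A X i j"
  unfolding attn_score_def by (simp add: matrix_vector_mult_scaleR power2_eq_square)

lemma attn_P_le_exp_gap:
  assumes "attn_score A Y i l \<le> attn_score A Y i J - g"
  shows "attn_P A Y i l \<le> exp (-g)"
proof -
  have "exp (attn_score A Y i J) \<le> (\<Sum>l\<in>UNIV. exp (attn_score A Y i l))"
    by (rule member_le_sum) auto
  then have "attn_P A Y i l \<le> exp (attn_score A Y i l) / exp (attn_score A Y i J)"
    unfolding attn_P_def using sum_exp_attn_score_pos[of A Y i] by (intro divide_left_mono) auto
  also have "\<dots> \<le> exp (-g)" using assms by (simp add: exp_diff[symmetric])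
  finally show ?thesis .
qed

lemma attn_P_variance_le:
  fixes A :: "real^'d^'d" and Y :: "real^'d^'n::finite"
  assumes gap: "\<And>l. l \<noteq> J \<Longrightarrow> attn_score A Y i l \<le> attn_score A Y i J - g"
  shows "attn_P A Y i j * (1 - attn_P A Y i j) \<le> real CARD('n) * exp (-g)"
proof (cases "j = J")
  case False
  have "attn_P A Y i j * (1 - attn_P A Y i j) \<le> attn_P A Y i j"
    using attn_P_nonneg[of A Y i j] attn_P_le_1[of A Y i j] by (simp add: mult_left_le)
  also have "\<dots> \<le> exp (-g)" using attn_P_le_exp_gap[OF gap[OF False]] .
  also have "\<dots> \<le> real CARD('n) * exp (-g)" by simp
  finally show ?thesis .
next
  case True
  have "1 - attn_P A Y i J = (\<Sum>l\<in>UNIV - {J}. attn_P A Y i l)"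
    by (simp add: sum_diff1 sum_attn_P)
  also have "\<dots> \<le> (\<Sum>l\<in>UNIV - {J}. exp (-g))"
    by (rule sum_mono) (auto intro: attn_P_le_exp_gap gap)
  also have "\<dots> \<le> real CARD('n) * exp (-g)"
    by (simp add: card_Diff_singleton_if)
  finally show ?thesis
    using True attn_P_nonneg[of A Y i J] attn_P_le_1[of A Y i J]
    by (smt (verit) mult_left_le_one_le)
qed

lemma finite_uniform_gap:
  fixes s :: "'i::finite \<Rightarrow> 'j::finite \<Rightarrow> real"
  assumes "\<And>i l. l \<noteq> J i \<Longrightarrow> s i l < s i (J i)"
  shows "\<exists>d>0. \<forall>i l. l \<noteq> J i \<longrightarrow> s i l \<le> s i (J i) - d"
proof -
  define G where "G = insert 1 ((\<lambda>(i,l). s i (J i) - s i l) ` {(i,l). l \<noteq> J i})"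
  have "finite G" "G \<noteq> {}" "\<forall>g\<in>G. g > 0" unfolding G_def using assms by auto
  then have "Min G > 0" by simp
  moreover have "s i l \<le> s i (J i) - Min G" if "l \<noteq> J i" for i l
  proof -
    have "s i (J i) - s i l \<in> G" using that unfolding G_def by force
    with \<open>finite G\<close> have "Min G \<le> s i (J i) - s i l" by (rule Min_le)
    then show ?thesis by simp
  qed
  ultimately show ?thesis by blast
qed

lemma E_set_score_gap:
  assumes "X \<in> E_set A"
  obtains J d where "d > 0" "\<And>i l. l \<noteq> J i \<Longrightarrow> attn_score A X i l \<le> attn_score A X i (J i) - d"
proof -
  let ?s = "attn_score A X"
  have "\<forall>i. \<exists>!j. \<forall>l. ?s i l \<le> ?s i j" using assms by (simp add: E_set_def)
  then obtain J where J: "\<And>i l. ?s i l \<le> ?s i (J i)"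
    and J_unique: "\<And>i j. \<forall>l. ?s i l \<le> ?s i j \<Longrightarrow> j = J i"
    by metis
  have "?s i l < ?s i (J i)" if "l \<noteq> J i" for i l
    using J[of i] J_unique[of i l] that by (meson not_less order_trans)
  with finite_uniform_gap[of J ?s] obtain d
    where "d > 0" "\<forall>i l. l \<noteq> J i \<longrightarrow> ?s i l \<le> ?s i (J i) - d"
    by blast
  then show thesis by (intro that) auto
qed

lemma onorm_self_attention_deriv_scaled_le:
  fixes A :: "real^'d^'d" and V :: "real^'d^'k" and X :: "real^'d^'n::finite"
  assumes "\<And>i l. l \<noteq> J i \<Longrightarrow> attn_score A X i l \<le> attn_score A X i (J i) - d"
  shows "onorm (frechet_derivative (self_attention A V) (at (R *\<^sub>R X)))
    \<le> (1 + (real CARD('n))^2 * 4 * onorm ((*v) A) * (norm X)^2 * (R^2 * exp (- (d * R^2))))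
       * onorm ((*v) V) * sqrt (real CARD('n))"
proof -
  have "attn_P A (R *\<^sub>R X) i j * (1 - attn_P A (R *\<^sub>R X) i j) \<le> real CARD('n) * exp (- (d * R^2))"
    for i j
  proof (rule attn_P_variance_le[where J = "J i"])
    fix l assume "l \<noteq> J i"
    then have "R^2 * attn_score A X i l \<le> R^2 * (attn_score A X i (J i) - d)"
      using assms by (intro mult_left_mono) auto
    then show "attn_score A (R *\<^sub>R X) i l \<le> attn_score A (R *\<^sub>R X) i (J i) - d * R^2"
      by (simp add: attn_score_scaleR algebra_simps)
  qed
  from onorm_self_attention_deriv_le[OF this, of V] show ?thesis
    by (simp add: frechet_derivative_self_attention power_mult_distrib power2_eq_square algebra_simps)
qed

lemma E_set_self_attention_deriv_bound:
  fixes A :: "real^'d^'d" and V :: "real^'d^'k" and X :: "real^'d^'n::finite"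
  assumes "X \<in> E_set A"
  obtains \<theta> :: "real \<Rightarrow> real" and C c :: real
  where "\<And>R. \<theta> R \<ge> 0" and "c > 0" and "\<forall>\<^sub>F R in at_top. \<bar>\<theta> R - 1\<bar> \<le> C * exp (- c * R)"
    and "\<And>R. onorm (frechet_derivative (self_attention A V) (at (R *\<^sub>R X)))
           \<le> \<theta> R * onorm ((*v) V) * sqrt (real CARD('n))"
proof -
  obtain J d where "d > 0"
    and gap: "\<And>i l. l \<noteq> J i \<Longrightarrow> attn_score A X i l \<le> attn_score A X i (J i) - d"
    using assms by (rule E_set_score_gap) blast
  define K where "K = (real CARD('n))^2 * 4 * onorm ((*v) A) * (norm X)^2"
  have "K \<ge> 0" unfolding K_def by (simp add: onorm_pos_le)
  define \<theta> where "\<theta> R = 1 + K * (R^2 * exp (- (d * R^2)))" for R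
  have \<theta>_nonneg: "\<theta> R \<ge> 0" for R unfolding \<theta>_def using \<open>K \<ge> 0\<close> by simp
  have \<theta>_decay: "\<forall>\<^sub>F R in at_top. \<bar>\<theta> R - 1\<bar> \<le> K * exp (- 1 * R)"
  proof -
    have "\<forall>\<^sub>F R in at_top. R^2 * exp (- (d * R^2)) \<le> exp (- R)"
      using \<open>d > 0\<close> by real_asymp
    then show ?thesis
      by eventually_elim (use \<open>K \<ge> 0\<close> in \<open>simp add: \<theta>_def mult_left_mono\<close>)
  qed
  have \<theta>_bound: "onorm (frechet_derivative (self_attention A V) (at (R *\<^sub>R X)))
      \<le> \<theta> R * onorm ((*v) V) * sqrt (real CARD('n))" for R
    using onorm_self_attention_deriv_scaled_le[OF gap, of V R] by (simp add: \<theta>_def K_def)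
  show thesis by (rule that[OF \<theta>_nonneg _ \<theta>_decay \<theta>_bound]) simp
qed

subsection \<open>Ties between scores are negligible\<close>

lemma negligible_mat_vec_nth_eq_0:
  fixes A :: "real^'d^'d"
  assumes "A \<noteq> 0"
  shows "negligible {X :: real^'d^'n::finite. A *v (X$i) = 0}"
proof -
  obtain k where k: "A$k \<noteq> 0" using assms by (metis vec_eq_iff zero_index)
  have "{X :: real^'d^'n. A *v (X$i) = 0} \<subseteq> {X. axis i (A$k) \<bullet> X = 0}"
  proof
    fix X :: "real^'d^'n" assume "X \<in> {X. A *v (X$i) = 0}"
    then have "(A *v (X$i))$k = 0" by simp
    then show "X \<in> {X. axis i (A$k) \<bullet> X = 0}"
      by (subst inner_axis') (simp add: matrix_vector_mult_def inner_vec_def)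
  qed
  moreover have "negligible {X :: real^'d^'n. axis i (A$k) \<bullet> X = 0}"
    by (rule negligible_hyperplane) (simp add: k)
  ultimately show ?thesis by (rule negligible_subset[rotated])
qed

lemma axis_axis_nth: "(axis j (axis k c) :: real^'d^'n) $ m $ p = (if m = j \<and> p = k then c else 0)"
  by (simp add: axis_def)

text \<open>The map \<open>F\<close> replaces the k-th coordinate of \<open>x_j\<close> by the tie defect, so ties are exactly
  its preimage of a coordinate hyperplane. As i \<noteq> j and l \<noteq> j, \<open>F\<close> leaves \<open>x_i\<close> and \<open>x_l\<close> alone,
  and its derivative is injective wherever \<open>(A x_i)_k \<noteq> 0\<close>.\<close>

lemma negligible_attn_score_tie_at_component:
  fixes A :: "real^'d^'d"
  assumes ij: "i \<noteq> j" and jl: "j \<noteq> l"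
  shows "negligible {X :: real^'d^'n::finite.
           attn_score A X i j = attn_score A X i l \<and> (A *v (X$i))$k \<noteq> 0}"
proof -
  define tie where "tie X = attn_score A X i j - attn_score A X i l" for X :: "real^'d^'n"
  define tie' where "tie' X H = attn_score_deriv A X H i j - attn_score_deriv A X H i l"
    for X H :: "real^'d^'n"
  define S where "S = {X :: real^'d^'n. (A *v (X$i))$k \<noteq> 0}"
  define F where "F X = X + axis j (axis k (tie X - X$j$k))" for X :: "real^'d^'n"
  define F' where "F' X H = H + axis j (axis k (tie' X H - H$j$k))" for X H :: "real^'d^'n"
  define T where "T = {Y :: real^'d^'n. axis j (axis k 1) \<bullet> Y = 0}"
  have T_negligible: "negligible T" unfolding T_def by (rule negligible_hyperplane) simp
  have F_deriv: "(F has_derivative F' X) (at X within S)" for X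
  proof -
    have "(tie has_derivative tie' X) (at X)"
      unfolding tie_def[abs_def] tie'_def by (intro has_derivative_diff has_derivative_attn_score)
    then have "((\<lambda>X. tie X - X$j$k) has_derivative (\<lambda>H. tie' X H - H$j$k)) (at X)"
      by (intro has_derivative_diff bounded_linear.has_derivative[OF
            bounded_linear_compose[OF bounded_linear_vec_nth bounded_linear_vec_nth] has_derivative_ident])
    then have "(F has_derivative F' X) (at X)" unfolding F_def[abs_def] F'_def[abs_def]
      by (intro has_derivative_add has_derivative_ident
          bounded_linear.has_derivative[OF bounded_linear_compose[OF bounded_linear_axis bounded_linear_axis]])
    then show ?thesis by (rule has_derivative_at_withinI)
  qed
  have F'_inj: "inj (F' X)" if "X \<in> S" for X
  proof (rule injI)
    fix H G assume eq: "F' X H = F' X G"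
    have same: "H$m$p = G$m$p" if "\<not> (m = j \<and> p = k)" for m p
      using arg_cong[OF eq, of "\<lambda>Z. Z$m$p"] that by (simp add: F'_def axis_axis_nth)
    have "tie' X H = tie' X G"
      using arg_cong[OF eq, of "\<lambda>Z. Z$j$k"] by (simp add: F'_def axis_axis_nth)
    moreover have "H$i = G$i" "H$l = G$l" using same ij jl by (auto simp: vec_eq_iff)
    ultimately have "(A *v (X$i)) \<bullet> (H$j - G$j) = 0"
      by (simp add: tie'_def attn_score_deriv_def inner_diff_right algebra_simps)
    moreover have "(A *v (X$i)) \<bullet> (H$j - G$j) = (A *v (X$i))$k * (H$j$k - G$j$k)"
      unfolding inner_vec_def using same by (subst sum.remove[of UNIV k]) (auto intro: sum.neutral)
    ultimately have "H$j$k = G$j$k" using that by (simp add: S_def)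
    then show "H = G" unfolding vec_eq_iff using same by metis
  qed
  have "negligible {X \<in> S. F X \<in> T}"
    by (rule negligible_differentiable_vimage[OF T_negligible F'_inj F_deriv])
  moreover have "{X \<in> S. F X \<in> T}
      = {X. attn_score A X i j = attn_score A X i l \<and> (A *v (X$i))$k \<noteq> 0}"
    by (auto simp: S_def T_def F_def tie_def inner_axis' axis_axis_nth)
  ultimately show ?thesis by simp
qed

lemma negligible_attn_score_tie:
  fixes A :: "real^'d^'d"
  assumes A: "A \<noteq> 0" and jl: "j \<noteq> l"
  shows "negligible {X :: real^'d^'n::finite. attn_score A X i j = attn_score A X i l}"
proof -
  have off_diagonal: "negligible {X :: real^'d^'n. attn_score A X i j = attn_score A X i l}"
    if ij: "i \<noteq> j" and jl: "j \<noteq> l" for j l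
  proof -
    have "{X :: real^'d^'n. attn_score A X i j = attn_score A X i l}
        \<subseteq> {X. A *v (X$i) = 0}
          \<union> (\<Union>k. {X. attn_score A X i j = attn_score A X i l \<and> (A *v (X$i))$k \<noteq> 0})"
      by (auto simp: vec_eq_iff)
    moreover have "negligible \<dots>"
      using negligible_mat_vec_nth_eq_0[OF A, where 'n='n, of i]
        negligible_attn_score_tie_at_component[OF ij jl, of A] by auto
    ultimately show ?thesis by (rule negligible_subset[rotated])
  qed
  show ?thesis
  proof (cases "i = j")
    case True
    have "{X :: real^'d^'n. attn_score A X i j = attn_score A X i l}
        = {X. attn_score A X i l = attn_score A X i j}" by auto
    with off_diagonal[of l j] True jl show ?thesis by simp
  qed (use off_diagonal jl in simp)
qed

lemma null_sets_unit_ball_seq_diff_E_set: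
  fixes A :: "real^'d^'d"
  assumes A: "A \<noteq> 0"
  shows "(unit_ball_seq - E_set A :: (real^'d^'n::finite) set) \<in> null_sets lebesgue"
proof -
  let ?ties = "\<Union>((\<lambda>(i,j,l). {X :: real^'d^'n. attn_score A X i j = attn_score A X i l})
                  ` {(i,j,l). j \<noteq> l})"
  have "unit_ball_seq - E_set A \<subseteq> ?ties"
  proof
    fix X :: "real^'d^'n" assume "X \<in> unit_ball_seq - E_set A"
    then obtain i where no_unique: "\<not> (\<exists>!j. \<forall>l. attn_score A X i l \<le> attn_score A X i j)"
      unfolding E_set_def by blast
    let ?s = "attn_score A X i"
    have "Max (range ?s) \<in> range ?s" by (rule Max_in) auto
    then obtain j where "?s j = Max (range ?s)" by (metis imageE)
    then have j_max: "\<forall>l. ?s l \<le> ?s j" by simp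
    with no_unique obtain j' where "\<forall>l. ?s l \<le> ?s j'" "j' \<noteq> j" by blast
    with j_max have "?s j = ?s j'" by (meson antisym)
    with \<open>j' \<noteq> j\<close> show "X \<in> ?ties" by blast
  qed
  moreover have "negligible ?ties"
    by (rule negligible_Union) (auto intro: negligible_attn_score_tie[OF A])
  ultimately have "negligible (unit_ball_seq - E_set A :: (real^'d^'n) set)"
    by (rule negligible_subset[rotated])
  then show ?thesis by (simp add: negligible_iff_null_sets)
qed

theorem mainTheorem8:
  fixes A :: "real^'d^'d" and V :: "real^'d^'k"
  assumes "A \<noteq> 0" and "V \<noteq> 0"
  shows "(unit_ball_seq - E_set A :: (real^'d^'n::finite) set) \<in> null_sets lebesgue
    \<and> (\<forall>X \<in> (E_set A :: (real^'d^'n) set).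
         \<exists>\<theta> :: real \<Rightarrow> real. (\<forall>R\<ge>0. \<theta> R \<ge> 0)
           \<and> (\<exists>C c. c > 0 \<and> (\<forall>\<^sub>F R in at_top. \<bar>\<theta> R - 1\<bar> \<le> C * exp (- c * R)))
           \<and> (\<forall>R\<ge>0. onorm (frechet_derivative (self_attention A V) (at (R *\<^sub>R X)))
                  \<le> \<theta> R * onorm (\<lambda>x. V *v x) * sqrt (real CARD('n))))"
  by (intro conjI ballI null_sets_unit_ball_seq_diff_E_set[OF \<open>A \<noteq> 0\<close>])
    (erule E_set_self_attention_deriv_bound[of _ A V], blast)

end
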